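(* Let $k\geq 2$ be an integer and let $G$ be a $2$-connected graph with $n$ vertices and $m$ edges, where $n\geq 2k-1$ and $m\geq (k-1)(n-1)+1$. Then $cc_{k}(G)\leq 2k-1$.
   Context: All graphs are finite, simple and undirected. An edge-coloring (not necessarily proper) of a graph is $k$-color connecting if between every pair of distinct vertices there is a path whose edges use at least $k$ different colors. $cc_{k}(G)$ is the minimum number of colors of a $k$-color connecting edge-coloring of $G$. *)

theory Defs
  imports Complex_Main "HOL-Library.Extended_Nat"
begin

text \<open>
  A graph is given by its vertex set \<open>V\<close> and its edge set \<open>E\<close>, where an edge is the
  two-element set of its end vertices; this excludes loops, multiple edges and orientations.
\<close>

definition fin_graph :: "'a set \<Rightarrow> 'a set set \<Rightarrow> bool" where
  "fin_graph V E \<longleftrightarrow> finite V \<and> (\<forall>e\<in>E. e \<subseteq> V \<and> card e = 2)"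

text \<open>Paths are represented by their vertex sequences.\<close>

fun path_edges :: "'a list \<Rightarrow> 'a set set" where
  "path_edges [] = {}"
| "path_edges [u] = {}"
| "path_edges (u # v # p) = insert {u, v} (path_edges (v # p))"

definition graph_path :: "'a set \<Rightarrow> 'a set set \<Rightarrow> 'a \<Rightarrow> 'a list \<Rightarrow> 'a \<Rightarrow> bool" where
  "graph_path V E u p v \<longleftrightarrow>
     p \<noteq> [] \<and> hd p = u \<and> last p = v \<and> distinct p \<and> set p \<subseteq> V \<and> path_edges p \<subseteq> E"

definition connected_graph :: "'a set \<Rightarrow> 'a set set \<Rightarrow> bool" where
  "connected_graph V E \<longleftrightarrow> V \<noteq> {} \<and> (\<forall>u\<in>V. \<forall>v\<in>V. \<exists>p. graph_path V E u p v)"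

text \<open>
  As usual, a 2-connected graph has more than two vertices (so the complete graph on two
  vertices is excluded) and remains connected whenever fewer than two vertices are deleted.
\<close>

definition two_connected :: "'a set \<Rightarrow> 'a set set \<Rightarrow> bool" where
  "two_connected V E \<longleftrightarrow>
     card V > 2 \<and> connected_graph V E \<and>
     (\<forall>v\<in>V. connected_graph (V - {v}) {e \<in> E. v \<notin> e})"

text \<open>
  Colors are natural numbers, which suffices as the graphs are finite. An edge-coloring is a
  function \<open>c\<close> of which only the values on \<open>E\<close> matter; adjacent edges may get the same color.
\<close>

definition color_connecting ::
    "nat \<Rightarrow> 'a set \<Rightarrow> 'a set set \<Rightarrow> ('a set \<Rightarrow> nat) \<Rightarrow> bool" where
  "color_connecting k V E c \<longleftrightarrow>
     (\<forall>u\<in>V. \<forall>v\<in>V. u \<noteq> v \<longrightarrow>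
        (\<exists>p. graph_path V E u p v \<and> k \<le> card (c ` path_edges p)))"

text \<open>
  The minimum number of colors occurring in a \<open>k\<close>-color connecting edge-coloring. It is
  \<open>\<infinity>\<close> if there is no such coloring, so that a finite upper bound includes existence.
\<close>

definition cc :: "nat \<Rightarrow> 'a set \<Rightarrow> 'a set set \<Rightarrow> enat" where
  "cc k V E = Inf {enat (card (c ` E)) | c. color_connecting k V E c}"

lemma cc_le_iff:
  "cc k V E \<le> enat r \<longleftrightarrow> (\<exists>c. color_connecting k V E c \<and> card (c ` E) \<le> r)"
proof
  let ?S = "{enat (card (c ` E)) | c. color_connecting k V E c}"
  assume le: "cc k V E \<le> enat r"
  have "?S \<noteq> {}"
  proof
    assume "?S = {}"
    then have "cc k V E = \<infinity>"
      by (simp only: cc_def Inf_enat_def if_True simp_thms)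
    with le show False
      by simp
  qed
  then obtain x where "x \<in> ?S"
    by blast
  then have "(LEAST x. x \<in> ?S) \<in> ?S"
    by (rule LeastI)
  with \<open>?S \<noteq> {}\<close> have "cc k V E \<in> ?S"
    by (simp only: cc_def Inf_enat_def if_False)
  with le show "\<exists>c. color_connecting k V E c \<and> card (c ` E) \<le> r"
    by auto
next
  assume "\<exists>c. color_connecting k V E c \<and> card (c ` E) \<le> r"
  then obtain c where c: "color_connecting k V E c" "card (c ` E) \<le> r"
    by blast
  then have "cc k V E \<le> enat (card (c ` E))"
    unfolding cc_def by (intro Inf_lower) blast
  with c(2) show "cc k V E \<le> enat r"
    by (meson enat_ord_simps(1) order_trans)
qed

end

theory Submission
  imports Defs
begin

text \<open>
  By the Erdos-Gallai bound, more than \<open>(k - 1) * (n - 1)\<close> edges force a cycle of length at least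
  \<open>2 * k - 1\<close>. Color its edges with all \<open>2 * k - 1\<close> colors: two vertices of the cycle split it into
  two arcs, one of which sees at least \<open>k\<close> colors. This property survives the addition of an ear
  with distinct ends, since every path through the ear can be completed by a good path between
  two old vertices; by 2-connectedness, ears exhaust the graph.

  For the Erdos-Gallai bound, in a graph without long cycles a nonempty set of vertices meeting
  at most \<open>k - 1\<close> edges per vertex is found at the end of a longest path and then deleted.
\<close>

section \<open>Edge sets of paths and cycles\<close>

lemma path_edges_append:
  "path_edges (xs @ ys) = path_edges xs \<union> path_edges ys \<union>
     (if xs = [] \<or> ys = [] then {} else {{last xs, hd ys}})"
proof (induction xs rule: path_edges.induct)
  case (2 u)
  then show ?case by (cases ys) auto
qed auto

lemma path_edges_rev: "path_edges (rev xs) = path_edges xs"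
proof (induction xs rule: path_edges.induct)
  case (3 u v p)
  have "path_edges (rev (u # v # p)) = path_edges (rev (v # p)) \<union> {{v, u}}"
    using path_edges_append[of "rev (v # p)" "[u]"] by simp
  also have "\<dots> = path_edges (u # v # p)"
    by (simp only: 3 path_edges.simps) (simp add: insert_commute)
  finally show ?case .
qed auto

lemma path_edges_subset: "e \<in> path_edges xs \<Longrightarrow> e \<subseteq> set xs"
  by (induction xs rule: path_edges.induct) auto

lemma finite_path_edges: "finite (path_edges xs)"
  by (induction xs rule: path_edges.induct) auto

lemma card_path_edges: "distinct xs \<Longrightarrow> card (path_edges xs) = length xs - 1"
proof (induction xs rule: path_edges.induct)
  case (3 u v p)
  then have "{u, v} \<notin> path_edges (v # p)"
    using path_edges_subset[of "{u, v}" "v # p"] by auto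
  with 3 show ?case by (simp add: finite_path_edges)
qed auto

text \<open>With at least three vertices the ends of \<open>p\<close> are not consecutive on
  \<open>p\<close>, so the closing edge is new.\<close>

lemma card_cycle_edges:
  assumes "distinct p" "length p \<ge> 3"
  shows "card (insert {last p, hd p} (path_edges p)) = length p"
proof -
  obtain a b q where p: "p = a # b # q" and "q \<noteq> []"
    using assms(2) by (cases p; cases "tl p") (auto simp: Suc_le_eq)
  have "{last p, hd p} \<notin> path_edges p"
  proof
    assume "{last p, hd p} \<in> path_edges p"
    then have "{last q, a} = {a, b} \<or> {last q, a} \<in> path_edges (b # q)"
      using p \<open>q \<noteq> []\<close> by auto
    then show False
    proof
      assume "{last q, a} = {a, b}"
      then have "last q = b \<or> last q = a" by (auto simp: doubleton_eq_iff)
      then show False using assms(1) p \<open>q \<noteq> []\<close> last_in_set[of q] by auto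
    next
      assume "{last q, a} \<in> path_edges (b # q)"
      then show False using path_edges_subset assms(1) p by fastforce
    qed
  qed
  then show ?thesis
    using card_path_edges[OF assms(1)] assms(2) by (simp add: finite_path_edges)
qed

lemma graph_path_rev: "graph_path V E u p v \<Longrightarrow> graph_path V E v (rev p) u"
  by (auto simp: graph_path_def path_edges_rev hd_rev last_rev)

lemma graph_path_mono: "graph_path V E u p v \<Longrightarrow> V \<subseteq> V' \<Longrightarrow> graph_path V' E u p v"
  by (auto simp: graph_path_def)

lemma graph_path_join:
  assumes "graph_path V E u p v" "graph_path V E u' q v'" "{v, u'} \<in> E" "set p \<inter> set q = {}"
  shows "graph_path V E u (p @ q) v'"
  using assms by (auto simp: graph_path_def path_edges_append)

text \<open>Every edge can be oriented in two ways; this is the double counting used for the edge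
  bounds below.\<close>

lemma card_oriented_edges:
  assumes "finite F" "\<forall>e\<in>F. card e = 2"
  shows "finite {(a, b). {a, b} \<in> F} \<and> card {(a, b). {a, b} \<in> F} = 2 * card F"
  using assms
proof (induction F rule: finite_induct)
  case (insert e F)
  obtain x y where e: "e = {x, y}" "x \<noteq> y"
    using insert.prems by (metis card_2_iff insertI1)
  have *: "{(a, b). {a, b} \<in> insert e F} = insert (x, y) (insert (y, x) {(a, b). {a, b} \<in> F})"
    using e by (auto simp: doubleton_eq_iff)
  have "{x, y} \<notin> F" "{y, x} \<notin> F"
    using insert.hyps e by (auto simp: insert_commute)
  then show ?case
    unfolding * using insert e by simp
qed simp

section \<open>Extending a color connecting set by ears\<close>

text \<open>The list \<open>q\<close> holds the inner vertices of an ear attached at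
  \<open>a\<close> and \<open>b\<close>. Every pair involving a vertex of \<open>q\<close> is joined
  by a path containing a whole good path between two distinct vertices of \<open>S\<close>.\<close>

lemma ear_extend:
  assumes cc: "color_connecting k S E c"
    and ab: "a \<in> S" "b \<in> S" "a \<noteq> b"
    and q: "graph_path Q E x q y" "{a, x} \<in> E" "{y, b} \<in> E" "set q \<inter> S = {}"
  shows "color_connecting k (S \<union> set q) E c"
proof -
  let ?S = "S \<union> set q"
  let ?con = "\<lambda>u v. \<exists>p. graph_path ?S E u p v \<and> k \<le> card (c ` path_edges p)"
  have sym: "?con v u" if "?con u v" for u v
    using that graph_path_rev path_edges_rev by metis
  have old: "\<exists>p. graph_path S E u p v \<and> k \<le> card (c ` path_edges p)"
    if "u \<in> S" "v \<in> S" "u \<noteq> v" for u v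
    using cc that unfolding color_connecting_def by blast
  have mono: "k \<le> card (c ` path_edges (p @ r @ p'))" if "k \<le> card (c ` path_edges r)" for p r p'
    using that card_mono[of "c ` path_edges (p @ r @ p')" "c ` path_edges r"]
    by (fastforce simp: finite_path_edges path_edges_append)
  \<comment> \<open>From an ear vertex \<open>u\<close>, the ear can be followed backwards to the
    neighbor \<open>x\<close> of \<open>a\<close>, or forwards to the neighbor \<open>y\<close> of
    \<open>b\<close>.\<close>
  have to_a: "graph_path (set q) E u (rev (q1 @ [u])) x" if "q = q1 @ u # q2" for q1 u q2
    using q(1) that unfolding graph_path_def path_edges_rev
    by (auto simp: path_edges_append hd_append last_rev split: if_splits)
  have to_b: "graph_path (set q) E u (u # q2) y" if "q = q1 @ u # q2" for q1 u q2
    using q(1) that by (auto simp: graph_path_def path_edges_append split: if_splits)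
  have SS: "S \<subseteq> ?S" "set q \<subseteq> ?S" by auto
  \<comment> \<open>The path enters \<open>S\<close> at \<open>a\<close>, unless
    \<open>v = a\<close>; then it enters at \<open>b\<close>. So the entry point always differs from
    \<open>v\<close>, and \<open>old\<close> applies.\<close>
  have mixed: "?con u v" if u: "u \<in> set q" and v: "v \<in> S" for u v
  proof -
    obtain q1 q2 where qq: "q = q1 @ u # q2" using u by (meson split_list)
    show ?thesis
    proof (cases "v = a")
      case False
      obtain r where r: "graph_path S E a r v" "k \<le> card (c ` path_edges r)"
        using old ab v False by metis
      have "graph_path ?S E u (rev (q1 @ [u]) @ r) v"
        using graph_path_mono[OF to_a[OF qq] SS(2)] graph_path_mono[OF r(1) SS(1)]
      proof (rule graph_path_join)
        show "{x, a} \<in> E" using q(2) by (simp add: insert_commute)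
        show "set (rev (q1 @ [u])) \<inter> set r = {}"
          using q(4) r(1) qq by (auto simp: graph_path_def)
      qed
      then show ?thesis using mono[OF r(2), of "rev (q1 @ [u])" "[]"] by auto
    next
      case True
      obtain r where r: "graph_path S E b r v" "k \<le> card (c ` path_edges r)"
        using old ab v True by metis
      have "graph_path ?S E u ((u # q2) @ r) v"
        using graph_path_mono[OF to_b[OF qq] SS(2)] graph_path_mono[OF r(1) SS(1)] q(3)
      proof (rule graph_path_join)
        show "set (u # q2) \<inter> set r = {}"
          using q(4) r(1) qq by (auto simp: graph_path_def)
      qed
      then show ?thesis using mono[OF r(2), of "u # q2" "[]"] by auto
    qed
  qed
  \<comment> \<open>For two ear vertices the segment between them may have too few colors. The path
    goes the other way round: from \<open>u\<close> back to \<open>a\<close>, through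
    \<open>S\<close> to \<open>b\<close>, and backwards along the ear to \<open>v\<close>.\<close>
  have ear: "?con u v" if qq: "q = q1 @ u # q2 @ v # q3" for u v q1 q2 q3
  proof -
    obtain r where r: "graph_path S E a r b" "k \<le> card (c ` path_edges r)"
      using old ab by metis
    have dq: "distinct q" using q(1) by (simp add: graph_path_def)
    have rS: "set r \<subseteq> S" using r(1) by (simp add: graph_path_def)
    have v: "graph_path (set q) E y (rev (v # q3)) v"
      using to_b[of "q1 @ u # q2" v q3] qq by (intro graph_path_rev) simp
    have "graph_path ?S E a (r @ rev (v # q3)) v"
      using graph_path_mono[OF r(1) SS(1)] graph_path_mono[OF v SS(2)]
    proof (rule graph_path_join)
      show "{b, y} \<in> E" using q(3) by (simp add: insert_commute)
      show "set r \<inter> set (rev (v # q3)) = {}" using q(4) rS qq by auto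
    qed
    with graph_path_mono[OF to_a[OF qq] SS(2)]
    have "graph_path ?S E u (rev (q1 @ [u]) @ (r @ rev (v # q3))) v"
    proof (rule graph_path_join)
      show "{x, a} \<in> E" using q(2) by (simp add: insert_commute)
      show "set (rev (q1 @ [u])) \<inter> set (r @ rev (v # q3)) = {}" using q(4) rS qq dq by auto
    qed
    then show ?thesis using mono[OF r(2)] by blast
  qed
  have "?con u v" if uv: "u \<in> ?S" "v \<in> ?S" "u \<noteq> v" for u v
  proof (cases "u \<in> S")
    case True
    show ?thesis
    proof (cases "v \<in> S")
      case True
      then show ?thesis
        using old[OF \<open>u \<in> S\<close> _ uv(3)] graph_path_mono[OF _ SS(1)] by metis
    next
      case False
      then have "v \<in> set q" using uv by blast
      then show ?thesis using sym[OF mixed[of v u]] \<open>u \<in> S\<close> by blast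
    qed
  next
    case False
    then have u: "u \<in> set q" using uv by auto
    show ?thesis
    proof (cases "v \<in> S")
      case True
      then show ?thesis using mixed u by blast
    next
      case False
      then have v: "v \<in> set q" using uv by auto
      obtain q1 q2 where qq: "q = q1 @ u # q2" using u by (meson split_list)
      then consider "v \<in> set q1" | "v \<in> set q2" using v uv(3) by auto
      then show ?thesis
      proof cases
        case 1
        then obtain q3 q4 where "q1 = q3 @ v # q4" by (meson split_list)
        then show ?thesis using ear[of q3 v q4 u q2] qq by (intro sym[of v u]) simp
      next
        case 2
        then obtain q3 q4 where "q2 = q3 @ v # q4" by (meson split_list)
        then show ?thesis using ear[of q1 u q3 v q4] qq by simp
      qed
    qed
  qed
  then show ?thesis unfolding color_connecting_def by blast
qed

text \<open>A path leaving \<open>S\<close> steps from \<open>a\<close> to its first outside vertex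
  \<open>x\<close>. Deleting \<open>a\<close> keeps the graph connected, so from \<open>x\<close>
  another path returns to \<open>S\<close> without using \<open>a\<close>, and it first meets
  \<open>S\<close> in some \<open>b\<close> different from \<open>a\<close>.\<close>

lemma exists_ear:
  assumes "two_connected V E" "S \<subset> V" "card S \<ge> 2"
  shows "\<exists>a\<in>S. \<exists>b\<in>S. \<exists>x q y. a \<noteq> b \<and> graph_path V E x q y \<and> {a, x} \<in> E \<and> {y, b} \<in> E
     \<and> set q \<inter> S = {}"
proof -
  obtain s t where st: "s \<in> S" "t \<in> V" "t \<notin> S"
    using assms(2,3) by (metis card.empty ex_in_conv not_numeral_le_zero psubset_imp_ex_mem DiffD1 DiffD2)
  then obtain p where p: "graph_path V E s p t"
    using assms(1,2) unfolding two_connected_def connected_graph_def by (meson psubsetD)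
  then have "\<exists>z\<in>set p. z \<notin> S"
    using st unfolding graph_path_def by (metis last_in_set)
  then obtain p1 x p2 where px: "p = p1 @ x # p2" "x \<notin> S" "\<forall>z\<in>set p1. z \<in> S"
    using split_list_first_prop[of p "\<lambda>z. z \<notin> S"] by metis
  have "p1 \<noteq> []" using p px st by (auto simp: graph_path_def)
  define a where "a = last p1"
  have a: "a \<in> S" "a \<in> V" "{a, x} \<in> E" "x \<in> V" "x \<noteq> a"
    using p px \<open>p1 \<noteq> []\<close> a_def assms(2) by (auto simp: graph_path_def path_edges_append)
  have "S \<noteq> {a}" using assms(3) by auto
  then obtain b' where b': "b' \<in> S" "b' \<noteq> a" using a(1) by blast
  have "connected_graph (V - {a}) {e \<in> E. a \<notin> e}"
    using assms(1) a(2) by (simp add: two_connected_def)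
  moreover have "x \<in> V - {a}" "b' \<in> V - {a}"
    using a b' assms(2) by auto
  ultimately obtain r where r: "graph_path (V - {a}) {e \<in> E. a \<notin> e} x r b'"
    unfolding connected_graph_def by blast
  then have "\<exists>z\<in>set r. z \<in> S"
    using b' unfolding graph_path_def by (metis last_in_set)
  then obtain q b r2 where rb: "r = q @ b # r2" "b \<in> S" "\<forall>z\<in>set q. z \<notin> S"
    using split_list_first_prop[of r "\<lambda>z. z \<in> S"] by metis
  \<comment> \<open>The return path starts at \<open>x\<close>, which lies outside \<open>S\<close>,
    so it has a vertex before \<open>b\<close>.\<close>
  have "q \<noteq> []" using r rb px(2) by (auto simp: graph_path_def)
  have "graph_path V E x q (last q)" "{last q, b} \<in> E" "b \<noteq> a"
    using r rb \<open>q \<noteq> []\<close> by (auto simp: graph_path_def path_edges_append)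
  moreover have "set q \<inter> S = {}" using rb(3) by blast
  ultimately show ?thesis using a(1,3) rb(2) by metis
qed

text \<open>Each ear has an inner vertex, so adding it lowers the number of vertices outside
  \<open>S\<close>.\<close>

lemma color_connecting_extend:
  assumes "finite V" "two_connected V E" "S \<subseteq> V" "card S \<ge> 2" "color_connecting k S E c"
  shows "color_connecting k V E c"
  using assms(3-5)
proof (induction "card (V - S)" arbitrary: S rule: less_induct)
  case less
  show ?case
  proof (cases "S = V")
    case False
    then have "S \<subset> V" using less.prems by blast
    then obtain a b x q y where q: "a \<in> S" "b \<in> S" "a \<noteq> b" "graph_path V E x q y" "{a, x} \<in> E"
      "{y, b} \<in> E" "set q \<inter> S = {}"
      using exists_ear[OF assms(2)] less.prems by meson
    have qV: "set q \<subseteq> V" "q \<noteq> []" using q(4) by (auto simp: graph_path_def)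
    show ?thesis
    proof (rule less.hyps[of "S \<union> set q"])
      have "V - (S \<union> set q) \<subset> V - S"
        using qV q(7) hd_in_set[OF qV(2)] by blast
      then show "card (V - (S \<union> set q)) < card (V - S)"
        using assms(1) by (intro psubset_card_mono) auto
      show "S \<union> set q \<subseteq> V" using qV less.prems by blast
      then show "card (S \<union> set q) \<ge> 2"
        using less.prems(2) card_mono[of "S \<union> set q" S] assms(1) finite_subset by fastforce
      show "color_connecting k (S \<union> set q) E c"
        using ear_extend[OF less.prems(3) q(1-7)] .
    qed
  qed (use less.prems in simp)
qed

section \<open>Colorful cycles\<close>

lemma cycle_color_connecting:
  assumes p: "distinct p" "path_edges p \<subseteq> E" "{last p, hd p} \<in> E"
    and colors: "2 * k - 1 \<le> card (c ` insert {last p, hd p} (path_edges p))"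
  shows "color_connecting k (set p) E c"
proof -
  let ?con = "\<lambda>u v. \<exists>r. graph_path (set p) E u r v \<and> k \<le> card (c ` path_edges r)"
  have sym: "?con v u" if "?con u v" for u v
    using that graph_path_rev path_edges_rev by metis
  have arcs: "?con u v" if pp: "p = A @ u # B @ v # D" for u v A B D
  proof -
    \<comment> \<open>The two arcs between \<open>u\<close> and \<open>v\<close>: \<open>?X\<close>
      runs along \<open>p\<close>, while \<open>?Y\<close> runs back from \<open>u\<close> to the
      start of \<open>p\<close>, over the closing edge to the end of \<open>p\<close>, and back to
      \<open>v\<close>.\<close>
    let ?X = "u # B @ [v]" and ?Y = "rev (A @ [u]) @ rev (v # D)"
    have l: "last (A @ [u]) = u" "hd (A @ [u]) = hd p" "last (v # D) = last p"
      using pp by (auto simp: hd_append)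
    have e: "path_edges p = path_edges A \<union> path_edges (u # B @ [v]) \<union> path_edges (v # D) \<union>
       (if A = [] then {} else {{last A, u}})"
      using pp path_edges_append[of "A" "u # B @ v # D"] path_edges_append[of "u # B @ [v]" D]
        path_edges_append[of "[v]" D] by auto
    have X: "graph_path (set p) E u ?X v"
      using p pp e by (auto simp: graph_path_def)
    have "path_edges ?Y = path_edges (A @ [u]) \<union> path_edges (v # D) \<union> {{hd p, last p}}"
      by (simp only: path_edges_append[of "rev (A @ [u])"] path_edges_rev)
        (use l in \<open>simp add: last_rev hd_rev del: rev.simps rev_append last.simps\<close>)
    also have "path_edges (A @ [u]) = path_edges A \<union> (if A = [] then {} else {{last A, u}})"
      by (simp add: path_edges_append)
    finally have eY: "path_edges ?Y = path_edges A \<union> (if A = [] then {} else {{last A, u}}) \<union>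
        path_edges (v # D) \<union> {{last p, hd p}}"
      by (simp add: insert_commute)
    have "hd ?Y = u" "last ?Y = v" "distinct ?Y" "set ?Y \<subseteq> set p"
      using p pp by auto
    moreover have "path_edges ?Y \<subseteq> E" using p e eY by auto
    ultimately have Y: "graph_path (set p) E u ?Y v"
      unfolding graph_path_def by blast
    have "insert {last p, hd p} (path_edges p) = path_edges ?X \<union> path_edges ?Y"
      unfolding eY e by auto
    then have "2 * k - 1 \<le> card (c ` path_edges ?X) + card (c ` path_edges ?Y)"
      using colors card_Un_le[of "c ` path_edges ?X" "c ` path_edges ?Y"]
      by (simp only: image_Un)
    \<comment> \<open>Two arcs with at most \<open>k - 1\<close> colors each would account for only
      \<open>2 * k - 2\<close> colors.\<close>
    then have "k \<le> card (c ` path_edges ?X) \<or> k \<le> card (c ` path_edges ?Y)"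
      by linarith
    then show ?thesis using X Y by blast
  qed
  have "?con u v" if uv: "u \<in> set p" "v \<in> set p" "u \<noteq> v" for u v
  proof -
    obtain q1 q2 where qq: "p = q1 @ u # q2" using uv by (meson split_list)
    then consider "v \<in> set q1" | "v \<in> set q2" using uv by auto
    then show ?thesis
    proof cases
      case 1
      then obtain q3 q4 where "q1 = q3 @ v # q4" by (meson split_list)
      then show ?thesis using arcs[of q3 v q4 u q2] qq by (intro sym[of v u]) simp
    next
      case 2
      then obtain q3 q4 where "q2 = q3 @ v # q4" by (meson split_list)
      then show ?thesis using arcs[of q1 u q3 v q4] qq by simp
    qed
  qed
  then show ?thesis unfolding color_connecting_def by blast
qed

section \<open>Long cycles in graphs with many edges\<close>

lemma exists_longest_path:
  assumes "finite V" "V \<noteq> {}"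
  obtains p where "p \<noteq> []" "distinct p" "set p \<subseteq> V" "path_edges p \<subseteq> E"
    "\<And>q. distinct q \<Longrightarrow> set q \<subseteq> V \<Longrightarrow> path_edges q \<subseteq> E \<Longrightarrow> length q \<le> length p"
proof -
  let ?P = "\<lambda>q. distinct q \<and> set q \<subseteq> V \<and> path_edges q \<subseteq> E"
  obtain v where "v \<in> V" using assms(2) by blast
  then have v: "?P [v]" by simp
  have bound: "\<forall>q. ?P q \<longrightarrow> length q < Suc (card V)"
    using assms(1) by (metis card_mono distinct_card less_Suc_eq_le)
  obtain p where p: "?P p" "\<And>q. ?P q \<Longrightarrow> length q \<le> length p"
    using ex_has_greatest_nat[of ?P, OF v bound] by blast
  then have "p \<noteq> []" using p(2)[OF v] by auto
  with p that show ?thesis by blast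
qed

text \<open>
  \<open>U\<close> is the set of possible first vertices of a longest path when its first \<open>2 * d\<close> vertices, the
  set \<open>W\<close>, may be permuted. All neighbors of \<open>u \<in> U\<close> lie in \<open>W\<close>, and Posa rotations show that there are
  at most \<open>card U\<close> of them. Twice the number of edges meeting \<open>U\<close> is the number of pairs \<open>(u, w)\<close>
  with \<open>u \<in> U\<close> and \<open>w\<close> adjacent to \<open>u\<close>, plus the number of those with \<open>w \<notin> U\<close>, hence at most
  \<open>card U * card U + card U * (2 * d - card U)\<close>.
\<close>

lemma sparse_set:
  assumes G: "fin_graph V E" and "V \<noteq> {}" and "d > 0"
    and no_cycle: "\<And>p. distinct p \<Longrightarrow> set p \<subseteq> V \<Longrightarrow> path_edges p \<subseteq> E \<Longrightarrow> {last p, hd p} \<in> E \<Longrightarrow>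
      length p \<le> 2 * d"
  shows "\<exists>U\<subseteq>V. U \<noteq> {} \<and> card U \<le> 2 * d \<and> card {e \<in> E. e \<inter> U \<noteq> {}} \<le> d * card U"
proof -
  have finV: "finite V" and E2: "\<And>e. e \<in> E \<Longrightarrow> e \<subseteq> V \<and> card e = 2"
    using G by (auto simp: fin_graph_def)
  have finE: "finite E"
    using finV E2 by (intro finite_subset[of E "Pow V"]) auto
  obtain P where P: "P \<noteq> []" "distinct P" "set P \<subseteq> V" "path_edges P \<subseteq> E"
    and longest: "\<And>q. distinct q \<Longrightarrow> set q \<subseteq> V \<Longrightarrow> path_edges q \<subseteq> E \<Longrightarrow> length q \<le> length P"
    using exists_longest_path[OF finV \<open>V \<noteq> {}\<close>] by metis
  define W where "W = set (take (2 * d) P)"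
  define T where "T = drop (2 * d) P"
  \<comment> \<open>The tail \<open>T\<close> stays fixed. Since \<open>q\<close> uses exactly the
    vertices of \<open>W\<close>, \<open>q @ T\<close> is again a longest path.\<close>
  define adm where "adm = (\<lambda>q. distinct q \<and> set q = W \<and> path_edges (q @ T) \<subseteq> E)"
  define U where "U = {hd q | q. adm q}"
  have PT: "take (2 * d) P @ T = P" by (simp add: T_def)
  have W: "W \<subseteq> V" "W \<inter> set T = {}" "set T \<subseteq> V" "distinct T" "finite W"
    using P by (auto simp: W_def T_def set_take_disj_set_drop_if_distinct dest: in_set_takeD in_set_dropD)
  have cardW: "card W = min (2 * d) (length P)"
    using P(2) by (simp add: W_def distinct_card min.commute)
  have lenq: "length q = card W" if "adm q" for q
    using that distinct_card[of q] by (auto simp: adm_def)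
  have "card W > 0" using cardW \<open>d > 0\<close> P(1) by simp
  then have adm_ne: "q \<noteq> []" if "adm q" for q using lenq[OF that] by auto
  have UW: "U \<subseteq> W"
    using adm_ne by (fastforce simp: U_def adm_def)
  have finU: "finite U" using UW W(5) finite_subset by blast
  have "adm (take (2 * d) P)"
    using P PT by (simp add: adm_def W_def)
  then have "U \<noteq> {}" by (auto simp: U_def)
  \<comment> \<open>A neighbor \<open>w\<close> in \<open>T\<close> would close a cycle through all
    of \<open>W\<close> and \<open>w\<close>; as \<open>T\<close> is then nonempty, \<open>W\<close>
    has exactly \<open>2 * d\<close> vertices and this cycle is too long. A neighbor outside the
    path would extend a longest path.\<close>
  have nbr: "w \<in> W" if q: "adm q" and w: "{hd q, w} \<in> E" for q w
  proof (rule ccontr)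
    assume "w \<notin> W"
    have qT: "distinct (q @ T)" "set (q @ T) \<subseteq> V" "path_edges (q @ T) \<subseteq> E" "q \<noteq> []"
      using q W adm_ne by (auto simp: adm_def)
    show False
    proof (cases "w \<in> set T")
      case True
      then obtain T1 T2 where T12: "T = T1 @ w # T2" by (meson split_list)
      have "length q = 2 * d"
        using lenq[OF q] cardW T12 by (cases "2 * d \<le> length P") (auto simp: T_def)
      moreover have "length (q @ T1 @ [w]) \<le> 2 * d"
      proof (rule no_cycle)
        show "path_edges (q @ T1 @ [w]) \<subseteq> E"
          using qT(3) path_edges_append[of "q @ T1 @ [w]" T2] T12 by auto
      qed (use qT T12 w in \<open>auto simp: insert_commute\<close>)
      ultimately show False by simp
    next
      case False
      have "length (w # q @ T) \<le> length P"
      proof (rule longest)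
        show "distinct (w # q @ T)" using qT(1) q False \<open>w \<notin> W\<close> by (auto simp: adm_def)
        show "set (w # q @ T) \<subseteq> V" using qT(2) E2[OF w] by auto
        show "path_edges (w # q @ T) \<subseteq> E"
          using qT w path_edges_append[of "[w]" "q @ T"] by (auto simp: insert_commute)
      qed
      moreover have "length P = length (q @ T)"
        using lenq[OF q] cardW by (auto simp: T_def min_def)
      ultimately show False by simp
    qed
  qed
  \<comment> \<open>Posa rotation: adding the edge from \<open>hd q\<close> to
    \<open>q ! Suc i\<close> and dropping the one between \<open>q ! i\<close> and
    \<open>q ! Suc i\<close> reverses the initial segment, which makes \<open>q ! i\<close> the
    first vertex. Only vertices of \<open>W\<close> change place.\<close>
  have rotate: "q ! i \<in> U" if q: "adm q" and i: "Suc i < length q" and e: "{hd q, q ! Suc i} \<in> E" for q i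
  proof -
    define A where "A = take (Suc i) q"
    define B where "B = drop (Suc i) q @ T"
    have A: "A \<noteq> []" "hd A = hd q" "last A = q ! i"
      using i by (auto simp: A_def take_Suc_conv_app_nth hd_append hd_conv_nth simp flip: length_greater_0_conv)
    have B: "B \<noteq> []" "hd B = q ! Suc i"
      using i by (auto simp: B_def hd_drop_conv_nth)
    have AB: "A @ B = q @ T" by (simp add: A_def B_def)
    have "path_edges (rev A @ B) \<subseteq> path_edges (A @ B) \<union> {{hd q, q ! Suc i}}"
      using A B by (auto simp: path_edges_append path_edges_rev last_rev)
    then have "path_edges (rev A @ B) \<subseteq> E"
      using q e unfolding AB by (auto simp: adm_def)
    moreover have "distinct (rev A @ drop (Suc i) q)" "set (rev A @ drop (Suc i) q) = W"
      using q set_append[of "take (Suc i) q" "drop (Suc i) q"]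
      by (auto simp: adm_def A_def set_take_disj_set_drop_if_distinct)
    ultimately have "adm (rev A @ drop (Suc i) q)"
      by (simp add: adm_def B_def)
    moreover have "hd (rev A @ drop (Suc i) q) = q ! i"
      using A by (simp add: hd_rev)
    ultimately show ?thesis unfolding U_def by (metis (mono_tags, lifting) mem_Collect_eq)
  qed
  define N where "N = (\<lambda>u. {w. {u, w} \<in> E})"
  have degree: "N u \<subseteq> W \<and> card (N u) \<le> card U" if "u \<in> U" for u
  proof -
    obtain q where q: "adm q" "u = hd q" using \<open>u \<in> U\<close> unfolding U_def by blast
    define J where "J = {i. Suc i < length q \<and> q ! i \<in> U}"
    have finJ: "finite J" by (rule finite_subset[of _ "{..<length q}"]) (auto simp: J_def)
    have NW: "N u \<subseteq> W" using nbr q by (auto simp: N_def)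
    \<comment> \<open>Each neighbor of \<open>u\<close> has a predecessor on \<open>q\<close>, which
      lies in \<open>U\<close> by \<open>rotate\<close>. Distinct positions in \<open>J\<close> give
      distinct elements of \<open>U\<close>, whence the bound on the degree.\<close>
    have "N u \<subseteq> (\<lambda>i. q ! Suc i) ` J"
    proof
      fix w assume w: "w \<in> N u"
      then have "w \<in> set q" using NW q by (auto simp: adm_def)
      then obtain j where j: "j < length q" "w = q ! j" by (metis in_set_conv_nth)
      have "w \<noteq> hd q" using w E2[of "{u, w}"] q by (auto simp: N_def)
      then have "j \<noteq> 0" using j by (metis hd_conv_nth list.size(3) not_less_zero)
      then obtain i where i: "j = Suc i" by (meson not0_implies_Suc)
      then have "i \<in> J" using rotate[OF q(1)] j w q by (auto simp: J_def N_def)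
      then show "w \<in> (\<lambda>i. q ! Suc i) ` J" using i j by blast
    qed
    then have "card (N u) \<le> card J"
      using finJ by (meson card_image_le card_mono finite_imageI le_trans)
    also have "card J \<le> card U"
    proof (rule card_inj_on_le[OF _ _ finU])
      show "inj_on ((!) q) J"
        using q by (auto simp: inj_on_def J_def adm_def nth_eq_iff_index_eq)
    qed (auto simp: J_def)
    finally show ?thesis using NW by blast
  qed
  let ?F = "{e \<in> E. e \<inter> U \<noteq> {}}"
  let ?s = "card U"
  have sd: "?s \<le> card W" "card W \<le> 2 * d"
    using card_mono[OF W(5) UW] cardW by simp_all
  \<comment> \<open>If only \<open>b\<close> lies in \<open>U\<close>, then \<open>degree\<close>
    applied to \<open>b\<close> places \<open>a\<close> in \<open>W\<close>.\<close>
  have "a \<in> U \<and> b \<in> N a \<or> a \<in> W - U \<and> b \<in> U" if "{a, b} \<in> ?F" for a b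
  proof -
    have "a \<in> W" if "b \<in> U"
      using degree[OF that] \<open>{a, b} \<in> ?F\<close> by (auto simp: N_def insert_commute[of a b])
    then show ?thesis using that by (auto simp: N_def)
  qed
  then have "{(a, b). {a, b} \<in> ?F} \<subseteq> (SIGMA u:U. N u) \<union> (W - U) \<times> U"
    by auto
  then have "card {(a, b). {a, b} \<in> ?F} \<le> card ((SIGMA u:U. N u) \<union> (W - U) \<times> U)"
    using finU W(5) degree by (intro card_mono finite_UnI finite_SigmaI) (auto intro: finite_subset)
  also have "\<dots> \<le> card (SIGMA u:U. N u) + card ((W - U) \<times> U)"
    by (rule card_Un_le)
  also have "card (SIGMA u:U. N u) = (\<Sum>u\<in>U. card (N u))"
    using finU W(5) degree by (intro card_SigmaI) (auto intro: finite_subset)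
  also have "\<dots> \<le> ?s * ?s"
    using degree sum_bounded_above[of U "\<lambda>u. card (N u)" "card U"] by simp
  also have "card ((W - U) \<times> U) = (card W - ?s) * ?s"
    using UW finU by (simp add: card_cartesian_product card_Diff_subset)
  also have "?s * ?s + (card W - ?s) * ?s = card W * ?s"
    using sd(1) by (metis add_mult_distrib le_add_diff_inverse)
  also have "\<dots> \<le> 2 * d * ?s" using sd(2) by simp
  finally have "card {(a, b). {a, b} \<in> ?F} \<le> 2 * d * ?s" by simp
  moreover have "card {(a, b). {a, b} \<in> ?F} = 2 * card ?F"
    using card_oriented_edges[of ?F] finE E2 by auto
  ultimately have "card ?F \<le> d * ?s" by simp
  then show ?thesis using UW W(1) \<open>U \<noteq> {}\<close> sd by (intro exI[of _ U]) auto
qed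

text \<open>Without a long cycle, deleting a sparse set \<open>U\<close> loses at most
  \<open>d * card U\<close> edges. The excess over \<open>d * (card V - 1)\<close> therefore
  survives in the smaller graph, to which induction applies.\<close>

lemma long_cycle:
  assumes "fin_graph V E" "d > 0" "card E > d * (card V - 1)"
  shows "\<exists>p. distinct p \<and> set p \<subseteq> V \<and> path_edges p \<subseteq> E \<and> {last p, hd p} \<in> E \<and> 2 * d < length p"
  using assms(1,3)
proof (induction "card V" arbitrary: V E rule: less_induct)
  case less
  have finV: "finite V" and E2: "\<And>e. e \<in> E \<Longrightarrow> e \<subseteq> V \<and> card e = 2"
    using less.prems by (auto simp: fin_graph_def)
  have finE: "finite E"
    using finV E2 by (intro finite_subset[of E "Pow V"]) auto
  have "E \<noteq> {}" using less.prems(2) by auto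
  then have "V \<noteq> {}" using E2 by fastforce
  show ?case
  proof (rule ccontr)
    assume no: "\<not> ?case"
    then obtain U where U: "U \<subseteq> V" "U \<noteq> {}" "card U \<le> 2 * d"
      and sparse: "card {e \<in> E. e \<inter> U \<noteq> {}} \<le> d * card U"
      using sparse_set[OF less.prems(1) \<open>V \<noteq> {}\<close> \<open>d > 0\<close>] by (meson not_le)
    show False
    proof (cases "U = V")
      case True
      \<comment> \<open>Here \<open>V\<close> itself has at most \<open>2 * d\<close> vertices, and
        even the complete graph on it has too few edges.\<close>
      have "2 * card E = card {(a, b). {a, b} \<in> E}"
        using card_oriented_edges[of E] finE E2 by simp
      also have "\<dots> \<le> card (SIGMA a:V. V - {a})"
        using E2 finV by (intro card_mono) fastforce+
      also have "\<dots> = card V * (card V - 1)"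
        using finV by simp
      also have "\<dots> \<le> 2 * d * (card V - 1)"
        using U(3) True by simp
      finally show False using less.prems(2) by simp
    next
      case False
      let ?E = "{e \<in> E. e \<inter> U = {}}"
      have finU: "finite U" using U(1) finV finite_subset by blast
      have lt: "card U < card V" using False U(1) finV by (simp add: psubset_card_mono psubset_eq)
      have cardVU: "card (V - U) = card V - card U"
        using U(1) finU by (simp add: card_Diff_subset)
      have "card E = card ?E + card {e \<in> E. e \<inter> U \<noteq> {}}"
        using finE by (subst card_Un_disjoint[symmetric]) (auto intro: arg_cong[of _ _ card])
      then have "card E \<le> card ?E + d * card U" using sparse by simp
      \<comment> \<open>As \<open>U\<close> is a proper subset, \<open>card (V - U)\<close> is
        positive and the subtraction of one is not truncated.\<close>
      moreover have "d * (card V - 1) = d * (card (V - U) - 1) + d * card U"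
        using lt cardVU by (simp flip: add_mult_distrib2)
      ultimately have big: "card ?E > d * (card (V - U) - 1)"
        using less.prems(2) by linarith
      have "card (V - U) < card V"
        using lt cardVU U(2) finU card_gt_0_iff[of U] by linarith
      moreover have "fin_graph (V - U) ?E"
        using finV E2 by (auto simp: fin_graph_def)
      ultimately obtain p where "distinct p" "set p \<subseteq> V - U" "path_edges p \<subseteq> ?E"
        "{last p, hd p} \<in> ?E" "2 * d < length p"
        using less.hyps[of "V - U" ?E] big by blast
      then have "distinct p \<and> set p \<subseteq> V \<and> path_edges p \<subseteq> E \<and> {last p, hd p} \<in> E \<and> 2 * d < length p"
        by auto
      then show False by (rule notE[OF no exI])
    qed
  qed
qed

section \<open>The coloring and the bound on its colors\<close>

text \<open>Controlling the whole range of \<open>c\<close> ensures that edges off the cycle bring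
  no further colors.\<close>

lemma exists_coloring_onto:
  assumes "finite C" "0 < r" "r \<le> card C"
  obtains c :: "'e \<Rightarrow> nat" where "c ` C = {..<r}" "range c \<subseteq> {..<r}"
proof -
  obtain D where D: "D \<subseteq> C" "card D = r" "finite D"
    using obtain_subset_with_card_n[OF assms(3)] by blast
  then obtain h where h: "bij_betw h D {..<r}"
    using ex_bij_betw_finite_nat[OF D(3)] by (auto simp: atLeast0LessThan)
  \<comment> \<open>All remaining elements get the default 0, which is an allowed color because
    \<open>0 < r\<close>.\<close>
  define c where "c = (\<lambda>e. if e \<in> D then h e else 0)"
  have "range c \<subseteq> {..<r}"
    using h assms(2) by (auto simp: c_def bij_betw_def)
  moreover have "{..<r} \<subseteq> c ` C"
  proof -
    have "c ` D = {..<r}" using h by (simp add: c_def bij_betw_def)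
    then show ?thesis using D(1) by blast
  qed
  ultimately show ?thesis using that by blast
qed

theorem theorem3p9:
  fixes k n m :: nat and V :: "'a set" and E :: "'a set set"
  assumes "k \<ge> 2"
    and "fin_graph V E"
    and "two_connected V E"
    and "n = card V"
    and "m = card E"
    and "n \<ge> 2 * k - 1"
    and "m \<ge> (k - 1) * (n - 1) + 1"
  shows "cc k V E \<le> enat (2 * k - 1)"
proof -
  have "finite V" using assms(2) by (simp add: fin_graph_def)
  \<comment> \<open>With \<open>d = k - 1\<close>, positive since \<open>k \<ge> 2\<close>, the
    cycle has at least \<open>2 * k - 1\<close> vertices, hence enough edges to show all
    colors.\<close>
  obtain p where p: "distinct p" "set p \<subseteq> V" "path_edges p \<subseteq> E" "{last p, hd p} \<in> E"
    and len: "2 * (k - 1) < length p"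
    using long_cycle[OF assms(2), of "k - 1"] assms(1,4,5,7) by auto
  let ?C = "insert {last p, hd p} (path_edges p)"
  have "length p \<ge> 3" using len assms(1) by linarith
  then have "card ?C = length p" using card_cycle_edges p(1) by blast
  then have "2 * k - 1 \<le> card ?C" using len by linarith
  then obtain c :: "'a set \<Rightarrow> nat" where c: "c ` ?C = {..<2 * k - 1}" "range c \<subseteq> {..<2 * k - 1}"
    using exists_coloring_onto[of ?C "2 * k - 1"] assms(1) finite_path_edges by auto
  have "color_connecting k (set p) E c"
    using p c(1) by (intro cycle_color_connecting) auto
  moreover have "card (set p) \<ge> 2"
    using p(1) \<open>length p \<ge> 3\<close> by (simp add: distinct_card)
  ultimately have "color_connecting k V E c"
    using color_connecting_extend[OF \<open>finite V\<close> assms(3) p(2)] by blast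
  moreover have "card (c ` E) \<le> 2 * k - 1"
    using card_mono[of "{..<2 * k - 1}" "c ` E"] c(2) by auto
  ultimately show ?thesis unfolding cc_le_iff by blast
qed

end
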